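(* Let $p\in\mathbb{N}$, $d_{\mathrm{refl}}(p):=\lfloor (p+2)/3\rfloor$, and let $K$ be a tetrahedron with vertices $A_0,A_1,A_2,A_3$. (a) The functions $Q^{(i)}_k$ on $\partial K$, $0\le k\le d_{\mathrm{refl}}(p)-1$, $i=0,1,2,3$, are linearly independent. (b) For every facet $T$ of $K$, $\operatorname{span}\{b^{\mathrm{refl}}_{p,m}\circ\chi_{\mathbf{V},T}^{-1}:\ \mathbf{V}\text{ a vertex of }T,\ 0\le m\le d_{\mathrm{refl}}(p)-1\}=\mathbb{P}^{\perp,\mathrm{refl}}_{p,p-1}(T)$.
   Context: $\widehat T$ is the triangle with vertices $(0,0),(1,0),(0,1)$. With Jacobi polynomials $P_m^{(\alpha,\beta)}$ ($P_m^{(\alpha,\beta)}(1)=(\alpha+1)_m/m!$) and Legendre polynomials $P^{(0,0)}_k$, $b_{p,k}(x_1,x_2):=(x_1+x_2)^kP^{(0,2k+1)}_{p-k}(2(x_1+x_2)-1)P^{(0,0)}_k\!\left(\frac{x_1-x_2}{x_1+x_2}\right)$. Let $Mq(x_1,x_2):=q(1-x_1-x_2,x_2)$, $Rq(x_1,x_2):=q(x_2,x_1)$, $\Pi:=\frac13(2I-MR-RM)$, and $b^{\mathrm{refl}}_{p,k}:=\Pi b_{p,2k}=\frac13\big(2b_{p,2k}(x_1,x_2)-b_{p,2k}(x_2,1-x_1-x_2)-b_{p,2k}(1-x_1-x_2,x_1)\big)$; it satisfies $b^{\mathrm{refl}}_{p,k}(x_1,x_2)=b^{\mathrm{refl}}_{p,k}(x_2,x_1)$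 and $t\mapsto b^{\mathrm{refl}}_{p,k}(t,1-t)$ is invariant under $t\mapsto 1-t$. $Q^{(0)}_k$ is the piecewise polynomial on $\partial K$ defined as follows: on each facet $A_0A_iA_j$ containing $A_0$ it equals $b^{\mathrm{refl}}_{p,k}$ in local coordinates mapping $A_0,A_i,A_j$ to $(0,0),(1,0),(0,1)$ (independent of the ordering of $A_i,A_j$); on the facet $A_1A_2A_3$ it is a totally symmetric polynomial of degree $p$ (invariant under all affine self-maps of that triangle) whose values on each edge agree with $t\mapsto b^{\mathrm{refl}}_{p,k}(t,1-t)$. $Q^{(i)}_k$, $i=1,2,3$, are defined analogously with $A_i$ in the role of $A_0$. For a triangle $T$ and vertex $\mathbf{V}$ of $T$, $\chi_{\mathbf{V},T}:\widehat T\to T$ is an affine bijection with $\chi_{\mathbf{V},T}(0)=\mathbf{V}$. $\mathbb{P}^{\perp,\mathrm{refl}}_{p,p-1}(\widehat T):=\operatorname{span}\{RM\Pi b_{p,2k},MR\Pi b_{p,2k}:0\le k\le\frac{p-1}{3}\}$ and $\mathbb{P}^{\perp,\mathrm{refl}}_{p,p-1}(T):=\{u\circ\chi_{\mathbf{P},T}^{-1}:u\in\mathbb{P}^{\perp,\mathrm{refl}}_{p,p-1}(\widehat T)\}$ for a vertex $\mathbf{P}$ of $T$ (independent of the choice of $\mathbf{P}$). *)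

theory Defs
  imports "HOL-Analysis.Analysis"
begin

definition That :: "(real \<times> real) set" where
  "That = {(x1, x2). 0 \<le> x1 \<and> 0 \<le> x2 \<and> x1 + x2 \<le> 1}"

text \<open>Jacobi polynomial (DLMF 18.5.8); normalisation P(1) = (alpha+1)_n / n!.\<close>
definition jacobi :: "nat \<Rightarrow> real \<Rightarrow> real \<Rightarrow> real \<Rightarrow> real" where
  "jacobi n \<alpha> \<beta> x =
     (\<Sum>s\<le>n. ((of_nat n + \<alpha>) gchoose (n - s)) * ((of_nat n + \<beta>) gchoose s)
             * ((x - 1) / 2) ^ s * ((x + 1) / 2) ^ (n - s))"

definition legendre :: "nat \<Rightarrow> real \<Rightarrow> real" where
  "legendre k x = jacobi k 0 0 x"

definition bpk :: "nat \<Rightarrow> nat \<Rightarrow> real \<times> real \<Rightarrow> real" where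
  "bpk p k x = (case x of (x1, x2) \<Rightarrow>
      (x1 + x2) ^ k * jacobi (p - k) 0 (2 * of_nat k + 1) (2 * (x1 + x2) - 1)
      * legendre k ((x1 - x2) / (x1 + x2)))"

definition Mop :: "(real \<times> real \<Rightarrow> real) \<Rightarrow> real \<times> real \<Rightarrow> real" where
  "Mop q x = (case x of (x1, x2) \<Rightarrow> q (1 - x1 - x2, x2))"

definition Rop :: "(real \<times> real \<Rightarrow> real) \<Rightarrow> real \<times> real \<Rightarrow> real" where
  "Rop q x = (case x of (x1, x2) \<Rightarrow> q (x2, x1))"

definition Piop :: "(real \<times> real \<Rightarrow> real) \<Rightarrow> real \<times> real \<Rightarrow> real" where
  "Piop q x = (2 * q x - Mop (Rop q) x - Rop (Mop q) x) / 3"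

definition brefl :: "nat \<Rightarrow> nat \<Rightarrow> real \<times> real \<Rightarrow> real" where
  "brefl p k = Piop (bpk p (2 * k))"

definition drefl :: "nat \<Rightarrow> nat" where
  "drefl p = (p + 2) div 3"

text \<open>P^{perp,refl}_{p,p-1}(That): span of RM Pi b_{p,2k}, MR Pi b_{p,2k}, 0 <= k <= (p-1)/3,
  as functions on That (values off That are irrelevant).\<close>
definition Pperp_hat :: "nat \<Rightarrow> (real \<times> real \<Rightarrow> real) set" where
  "Pperp_hat p = {u. \<exists>a c. \<forall>x\<in>That.
      u x = (\<Sum>k\<in>{k. 3 * k + 1 \<le> p}.
               a k * Rop (Mop (brefl p k)) x + c k * Mop (Rop (brefl p k)) x)}"

definition poly2_le :: "nat \<Rightarrow> (real \<times> real \<Rightarrow> real) \<Rightarrow> bool" where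
  "poly2_le p S \<longleftrightarrow> (\<exists>c :: nat \<Rightarrow> nat \<Rightarrow> real. \<forall>x1 x2.
      S (x1, x2) = (\<Sum>i\<le>p. \<Sum>j\<le>p - i. c i j * x1 ^ i * x2 ^ j))"

definition That_maps :: "(real \<times> real \<Rightarrow> real \<times> real) set" where
  "That_maps = {\<lambda>(x1, x2). (x1, x2), \<lambda>(x1, x2). (x2, x1),
                \<lambda>(x1, x2). (1 - x1 - x2, x2), \<lambda>(x1, x2). (x2, 1 - x1 - x2),
                \<lambda>(x1, x2). (1 - x1 - x2, x1), \<lambda>(x1, x2). (x1, 1 - x1 - x2)}"

definition tot_sym :: "(real \<times> real \<Rightarrow> real) \<Rightarrow> bool" where
  "tot_sym S \<longleftrightarrow> (\<forall>g\<in>That_maps. \<forall>x\<in>That. S (g x) = S x)"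

definition chi :: "real^3 \<Rightarrow> real^3 \<Rightarrow> real^3 \<Rightarrow> real \<times> real \<Rightarrow> real^3" where
  "chi V W U x = V + fst x *\<^sub>R (W - V) + snd x *\<^sub>R (U - V)"

definition bdry :: "(nat \<Rightarrow> real^3) \<Rightarrow> (real^3) set" where
  "bdry A = (\<Union>i\<in>{0..3::nat}. convex hull (A ` ({0..3} - {i})))"

definition Qprop :: "nat \<Rightarrow> (nat \<Rightarrow> real^3) \<Rightarrow> nat \<Rightarrow> nat \<Rightarrow> (real^3 \<Rightarrow> real) \<Rightarrow> bool" where
  "Qprop p A i k f \<longleftrightarrow>
     (\<forall>j l. j \<in> {0..3} \<and> l \<in> {0..3} \<and> distinct [i, j, l] \<longrightarrow>
        (\<forall>x\<in>That. f (chi (A i) (A j) (A l) x) = brefl p k x)) \<and>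
     (\<exists>S. poly2_le p S \<and> tot_sym S \<and>
        (\<forall>t\<in>{0..1}. S (t, 1 - t) = brefl p k (t, 1 - t) \<and>
                     S (t, 0) = brefl p k (t, 1 - t) \<and>
                     S (0, t) = brefl p k (t, 1 - t)) \<and>
        (\<forall>j l m. {j, l, m} \<subseteq> {0..3} \<and> distinct [i, j, l, m] \<longrightarrow>
           (\<forall>x\<in>That. f (chi (A j) (A l) (A m) x) = S x)))"

end

theory Submission
  imports Defs
begin

text \<open>With \<open>z = 1 - x - y\<close>, the functions \<open>b\<^sub>p\<^sub>,\<^sub>k\<close> become homogeneous forms
  \<open>\<Sum> c\<^sub>i\<^sub>j\<^sub>l x\<^sup>i y\<^sup>j z\<^sup>l / (i! j! l!)\<^sup>2\<close> of degree \<open>p\<close> annihilated by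
  \<open>\<partial>\<^sub>x x \<partial>\<^sub>x + \<partial>\<^sub>y y \<partial>\<^sub>y + \<partial>\<^sub>z z \<partial>\<^sub>z\<close>, that is, with
  \<open>c\<^sub>i\<^sub>+\<^sub>1\<^sub>,\<^sub>j\<^sub>,\<^sub>l + c\<^sub>i\<^sub>,\<^sub>j\<^sub>+\<^sub>1\<^sub>,\<^sub>l + c\<^sub>i\<^sub>,\<^sub>j\<^sub>,\<^sub>l\<^sub>+\<^sub>1 = 0\<close>. This class of forms is
  invariant under permutations of the variables, and a member that vanishes on one edge is zero.
  It replaces orthogonality to polynomials of lower degree.

  In a linear relation between the \<open>Q\<close>'s, restrict to the facet opposite to the vertex \<open>m\<close> and sum
  over the rotations of that facet: the reflection-type parts cancel, hence the totally symmetric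
  combination \<open>\<Sum>\<^sub>k c\<^sub>m\<^sub>,\<^sub>k Q\<^sub>k\<close> vanishes there. So \<open>\<Sum>\<^sub>k c\<^sub>m\<^sub>,\<^sub>k b\<^sup>r\<^sup>e\<^sup>f\<^sup>l\<^sub>p\<^sub>,\<^sub>k\<close> vanishes on
  an edge, hence identically, and it remains to see that the \<open>b\<^sup>r\<^sup>e\<^sup>f\<^sup>l\<^sub>p\<^sub>,\<^sub>k\<close> are independent. The
  second part holds because the three rotations of \<open>b\<^sup>r\<^sup>e\<^sup>f\<^sup>l\<^sub>p\<^sub>,\<^sub>k\<close> sum to zero.\<close>

section \<open>Harmonic coefficient arrays\<close>

definition triples :: "nat \<Rightarrow> (nat \<times> nat \<times> nat) set" where
  "triples p = {(i, j, l). i + j + l = p}"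

text \<open>The operator d/dx x d/dx sends \<open>x ^ i / (fact i)\<^sup>2\<close> to
  \<open>x ^ (i - 1) / (fact (i - 1))\<^sup>2\<close>. With these weights the differential equation
  is a recurrence with constant coefficients.\<close>

definition hform :: "nat \<Rightarrow> (nat \<Rightarrow> nat \<Rightarrow> nat \<Rightarrow> real) \<Rightarrow> real \<Rightarrow> real \<Rightarrow> real \<Rightarrow> real" where
  "hform p c x y z = (\<Sum>(i, j, l)\<in>triples p.
     c i j l * (x ^ i / (fact i)\<^sup>2) * (y ^ j / (fact j)\<^sup>2) * (z ^ l / (fact l)\<^sup>2))"

definition harmonic_coeffs :: "nat \<Rightarrow> (nat \<Rightarrow> nat \<Rightarrow> nat \<Rightarrow> real) \<Rightarrow> bool" where
  "harmonic_coeffs p c \<longleftrightarrow>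
     (\<forall>i j l. Suc (i + j + l) = p \<longrightarrow> c (Suc i) j l + c i (Suc j) l + c i j (Suc l) = 0)"

definition harmonic_forms :: "nat \<Rightarrow> (real \<Rightarrow> real \<Rightarrow> real \<Rightarrow> real) set" where
  "harmonic_forms p = {F. \<exists>c. harmonic_coeffs p c \<and> (\<forall>x y z. F x y z = hform p c x y z)}"

text \<open>Grouping by powers of \<open>z\<close> isolates the layer \<open>l = 0\<close> on the
  edge \<open>z = 0\<close> and matches the expansion of \<open>bhom\<close> in
  \<open>z\<close>.\<close>

lemma hform_nested:
  "hform p c x y z = (\<Sum>l\<le>p. (\<Sum>i\<le>p - l.
     c i (p - l - i) l * (x ^ i / (fact i)\<^sup>2) * (y ^ (p - l - i) / (fact (p - l - i))\<^sup>2))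
     * (z ^ l / (fact l)\<^sup>2))"
proof -
  have "hform p c x y z = (\<Sum>(l, i)\<in>(SIGMA l:{..p}. {..p - l}).
     c i (p - l - i) l * (x ^ i / (fact i)\<^sup>2) * (y ^ (p - l - i) / (fact (p - l - i))\<^sup>2)
     * (z ^ l / (fact l)\<^sup>2))"
    unfolding hform_def triples_def
    by (rule sum.reindex_bij_witness[where i = "\<lambda>(l, i). (i, p - l - i, l)" and j = "\<lambda>(i, j, l). (l, i)"])
       auto
  also have "\<dots> = (\<Sum>l\<le>p. \<Sum>i\<le>p - l.
     c i (p - l - i) l * (x ^ i / (fact i)\<^sup>2) * (y ^ (p - l - i) / (fact (p - l - i))\<^sup>2)
     * (z ^ l / (fact l)\<^sup>2))"
    by (rule sum.Sigma[symmetric]) auto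
  finally show ?thesis by (simp only: sum_distrib_right)
qed

lemma harmonic_forms_zero: "(\<lambda>x y z. 0) \<in> harmonic_forms p"
  unfolding harmonic_forms_def harmonic_coeffs_def hform_def
  by (auto intro!: exI[of _ "\<lambda>i j l. 0"])

lemma harmonic_forms_add:
  assumes "F \<in> harmonic_forms p" "G \<in> harmonic_forms p"
  shows "(\<lambda>x y z. F x y z + G x y z) \<in> harmonic_forms p"
proof -
  from assms obtain c d where c: "harmonic_coeffs p c" "\<And>x y z. F x y z = hform p c x y z"
    and d: "harmonic_coeffs p d" "\<And>x y z. G x y z = hform p d x y z"
    unfolding harmonic_forms_def by auto
  have "harmonic_coeffs p (\<lambda>i j l. c i j l + d i j l)"
    using c(1) d(1) unfolding harmonic_coeffs_def by (fastforce simp: algebra_simps)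
  moreover have "F x y z + G x y z = hform p (\<lambda>i j l. c i j l + d i j l) x y z" for x y z
    unfolding c(2) d(2) hform_def
    by (simp only: case_prod_beta' distrib_right sum.distrib)
  ultimately show ?thesis unfolding harmonic_forms_def by blast
qed

lemma harmonic_forms_scale:
  assumes "F \<in> harmonic_forms p"
  shows "(\<lambda>x y z. a * F x y z) \<in> harmonic_forms p"
proof -
  from assms obtain c where c: "harmonic_coeffs p c" "\<And>x y z. F x y z = hform p c x y z"
    unfolding harmonic_forms_def by auto
  have "harmonic_coeffs p (\<lambda>i j l. a * c i j l)"
    using c(1) unfolding harmonic_coeffs_def by (simp flip: distrib_left)
  moreover have "a * F x y z = hform p (\<lambda>i j l. a * c i j l) x y z" for x y z
    unfolding c(2) hform_def
    by (simp add: case_prod_beta sum_distrib_left mult.assoc)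
  ultimately show ?thesis unfolding harmonic_forms_def by blast
qed

lemma harmonic_forms_sum:
  assumes "\<And>k. k \<in> K \<Longrightarrow> F k \<in> harmonic_forms p"
  shows "(\<lambda>x y z. \<Sum>k\<in>K. F k x y z) \<in> harmonic_forms p"
  using assms
  by (induction K rule: infinite_finite_induct)
     (auto simp: harmonic_forms_zero intro!: harmonic_forms_add)

lemma harmonic_forms_rotate:
  assumes "F \<in> harmonic_forms p"
  shows "(\<lambda>x y z. F y z x) \<in> harmonic_forms p"
proof -
  from assms obtain c where c: "harmonic_coeffs p c" "\<And>x y z. F x y z = hform p c x y z"
    unfolding harmonic_forms_def by auto
  have "harmonic_coeffs p (\<lambda>i j l. c j l i)"
    unfolding harmonic_coeffs_def
  proof (intro allI impI)
    fix i j l assume "Suc (i + j + l) = p"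
    then have "Suc (j + l + i) = p" by simp
    with c(1) show "c j l (Suc i) + c (Suc j) l i + c j (Suc l) i = 0"
      unfolding harmonic_coeffs_def by (fastforce simp: algebra_simps)
  qed
  moreover have "F y z x = hform p (\<lambda>i j l. c j l i) x y z" for x y z
    unfolding c(2) hform_def triples_def
    by (rule sum.reindex_bij_witness[where i = "\<lambda>(i, j, l). (j, l, i)" and j = "\<lambda>(j, l, i). (i, j, l)"])
       (auto simp: mult_ac)
  ultimately show ?thesis unfolding harmonic_forms_def by blast
qed

text \<open>Substituting \<open>t = y / (1 + y)\<close> and multiplying by
  \<open>(1 + y) ^ p\<close> turns the Bernstein sum into an ordinary polynomial in \<open>y\<close>
  with infinitely many roots.\<close>

lemma bernstein_coeffs_zero:
  fixes a :: "nat \<Rightarrow> real"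
  assumes "\<And>t. 0 < t \<Longrightarrow> t < 1 \<Longrightarrow> (\<Sum>i\<le>p. a i * t ^ i * (1 - t) ^ (p - i)) = 0"
    and "i \<le> p"
  shows "a i = 0"
proof -
  have "(\<Sum>i\<le>p. a i * y ^ i) = 0" if "y > 0" for y
  proof -
    have e: "1 - y / (1 + y) = 1 / (1 + y)" using that by (simp add: field_simps)
    have "0 = (1 + y) ^ p * (\<Sum>i\<le>p. a i * (y / (1 + y)) ^ i * (1 - y / (1 + y)) ^ (p - i))"
      using that by (subst assms(1)) auto
    also have "\<dots> = (\<Sum>i\<le>p. a i * y ^ i)"
      unfolding sum_distrib_left
    proof (rule sum.cong[OF refl])
      fix i assume "i \<in> {..p}"
      then have "(1 + y) ^ p = (1 + y) ^ i * (1 + y) ^ (p - i)" by (simp flip: power_add)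
      then show "(1 + y) ^ p * (a i * (y / (1 + y)) ^ i * (1 - y / (1 + y)) ^ (p - i)) = a i * y ^ i"
        unfolding e using that by (simp add: power_divide)
    qed
    finally show ?thesis by simp
  qed
  then have "{0<..} \<subseteq> {y. (\<Sum>i\<le>p. a i * y ^ i) = 0}" by auto
  moreover have "infinite {0::real<..}" by (rule infinite_Ioi)
  ultimately have "infinite {y. (\<Sum>i\<le>p. a i * y ^ i) = 0}"
    using finite_subset by blast
  then show ?thesis using polyfun_finite_roots assms(2) by blast
qed

text \<open>The recurrence determines the whole array from its layer \<open>l = 0\<close>, which is read off
  from the edge \<open>z = 0\<close>.\<close>
lemma harmonic_form_zero_if_zero_on_edge:
  assumes "F \<in> harmonic_forms p" and "\<And>t. 0 < t \<Longrightarrow> t < 1 \<Longrightarrow> F t (1 - t) 0 = 0"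
  shows "F x y z = 0"
proof -
  from assms obtain c where c: "harmonic_coeffs p c" "\<And>x y z. F x y z = hform p c x y z"
    unfolding harmonic_forms_def by auto
  have edge: "F x y 0 = (\<Sum>i\<le>p. c i (p - i) 0 / ((fact i)\<^sup>2 * (fact (p - i))\<^sup>2) * x ^ i * y ^ (p - i))" for x y
  proof -
    let ?h = "\<lambda>l. \<Sum>i\<le>p - l. c i (p - l - i) l * (x ^ i / (fact i)\<^sup>2)
                * (y ^ (p - l - i) / (fact (p - l - i))\<^sup>2)"
    have "F x y 0 = (\<Sum>l\<le>p. if l = 0 then ?h 0 else 0)"
      unfolding c(2) hform_nested by (rule sum.cong) auto
    also have "\<dots> = ?h 0" by simp
    finally show ?thesis by (simp add: mult.assoc)
  qed
  have zero: "c i (p - i) 0 = 0" if "i \<le> p" for i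
    using bernstein_coeffs_zero[where p = p and i = i
        and a = "\<lambda>i. c i (p - i) 0 / ((fact i)\<^sup>2 * (fact (p - i))\<^sup>2)"]
      assms(2) that unfolding edge by auto
  have "\<forall>i j. i + j + l = p \<longrightarrow> c i j l = 0" for l
  proof (induction l)
    case 0
    then show ?case using zero by (metis add.right_neutral diff_add_inverse le_add1)
  next
    case (Suc l)
    show ?case
    proof (intro allI impI)
      fix i j assume "i + j + Suc l = p"
      with c(1) have "c (Suc i) j l + c i (Suc j) l + c i j (Suc l) = 0"
        unfolding harmonic_coeffs_def by auto
      moreover have "c (Suc i) j l = 0" "c i (Suc j) l = 0"
        using Suc \<open>i + j + Suc l = p\<close> by auto
      ultimately show "c i j (Suc l) = 0" by simp
    qed
  qed
  then show ?thesis unfolding c(2) hform_def triples_def by (auto intro!: sum.neutral)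
qed

section \<open>The orthogonal basis in homogeneous coordinates\<close>

text \<open>The homogenisation of \<open>jacobi n 0 \<beta> x\<close> with \<open>z = (1 - x) / 2\<close>, \<open>s = (1 + x) / 2\<close>.\<close>
definition jacobi_hom :: "nat \<Rightarrow> nat \<Rightarrow> real \<Rightarrow> real \<Rightarrow> real" where
  "jacobi_hom n \<beta> z s =
     (\<Sum>r\<le>n. real (n choose r) * real ((n + \<beta>) choose r) * (- z) ^ r * s ^ (n - r))"

text \<open>The power \<open>(x + y) ^ k\<close> of \<open>bpk\<close> is absorbed by homogenising
  the Legendre factor, which removes the division by \<open>x + y\<close>.\<close>

definition bhom :: "nat \<Rightarrow> nat \<Rightarrow> real \<Rightarrow> real \<Rightarrow> real \<Rightarrow> real" where
  "bhom p k x y z = jacobi_hom (p - k) (2 * k + 1) z (x + y) * jacobi_hom k 0 y x"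

definition bhom_refl :: "nat \<Rightarrow> nat \<Rightarrow> real \<Rightarrow> real \<Rightarrow> real \<Rightarrow> real" where
  "bhom_refl p k x y z =
     (2 * bhom p (2 * k) x y z - bhom p (2 * k) y z x - bhom p (2 * k) z x y) / 3"

lemma jacobi_eq_jacobi_hom:
  "jacobi n 0 (real \<beta>) x = jacobi_hom n \<beta> ((1 - x) / 2) ((x + 1) / 2)"
  unfolding jacobi_def jacobi_hom_def
proof (rule sum.cong[OF refl])
  fix s assume "s \<in> {..n}"
  then have "real n gchoose (n - s) = real (n choose s)"
    by (simp add: binomial_gbinomial[symmetric] binomial_symmetric[of s n])
  moreover have "(real n + real \<beta>) gchoose s = real ((n + \<beta>) choose s)"
    by (simp add: binomial_gbinomial)
  moreover have "(x - 1) / 2 = - ((1 - x) / 2)" by (simp add: field_simps)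
  ultimately show "(real n + 0 gchoose (n - s)) * (real n + real \<beta> gchoose s) * ((x - 1) / 2) ^ s * ((x + 1) / 2) ^ (n - s)
     = real (n choose s) * real (n + \<beta> choose s) * (- ((1 - x) / 2)) ^ s * ((x + 1) / 2) ^ (n - s)"
    by (simp only: add_0_right)
qed

lemma jacobi_hom_scale: "jacobi_hom n \<beta> (a * z) (a * s) = a ^ n * jacobi_hom n \<beta> z s"
proof -
  have "(- (a * z)) ^ r * (a * s) ^ (n - r) = a ^ n * ((- z) ^ r * s ^ (n - r))" if "r \<le> n" for r
  proof -
    have "(- (a * z)) ^ r * (a * s) ^ (n - r) = (a ^ r * a ^ (n - r)) * ((- z) ^ r * s ^ (n - r))"
      unfolding mult_minus_right[symmetric] power_mult_distrib by (simp only: mult_ac)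
    also have "a ^ r * a ^ (n - r) = a ^ n" using that by (simp flip: power_add)
    finally show ?thesis .
  qed
  then show ?thesis
    unfolding jacobi_hom_def sum_distrib_left
    by (intro sum.cong) (auto simp: mult_ac)
qed

text \<open>For \<open>s = x + y\<close> this is the restriction to the plane
  \<open>x + y + z = 0\<close>, where the Jacobi factor collapses to a multiple of a power of
  \<open>x + y\<close>.\<close>

lemma jacobi_hom_at_infinity: "jacobi_hom n \<beta> (- s) s = s ^ n * jacobi_hom n \<beta> (- 1) 1"
  using jacobi_hom_scale[of n \<beta> s "-1" 1] by simp

lemma jacobi_hom_minus_one_pos: "jacobi_hom n \<beta> (- 1) 1 > 0"
  unfolding jacobi_hom_def by (rule sum_pos2[of _ 0]) auto

lemma bpk_eq_bhom:
  assumes "(x, y) \<in> That"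
  shows "bpk p k (x, y) = bhom p k x y (1 - x - y)"
proof -
  have "jacobi (p - k) 0 (2 * of_nat k + 1) (2 * (x + y) - 1)
      = jacobi_hom (p - k) (2 * k + 1) (1 - x - y) (x + y)"
  proof -
    have "(1 - (2 * (x + y) - 1)) / 2 = 1 - x - y" "(2 * (x + y) - 1 + 1) / 2 = x + y"
      by (simp_all add: field_simps)
    moreover have "real (2 * k + 1) = 2 * of_nat k + 1" by simp
    ultimately show ?thesis
      using jacobi_eq_jacobi_hom[of "p - k" "2 * k + 1" "2 * (x + y) - 1"] by (simp only:)
  qed
  moreover have "(x + y) ^ k * legendre k ((x - y) / (x + y)) = jacobi_hom k 0 y x"
  \<comment> \<open>At the origin the quotient is 0 by convention. This is harmless: the power
    vanishes for \<open>k > 0\<close>, and the Legendre factor is constant for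
    \<open>k = 0\<close>.\<close>
  proof (cases "x + y = 0")
    case True
    with assms have "x = 0" "y = 0" unfolding That_def by auto
    then show ?thesis
      using jacobi_hom_scale[of k 0 0 0 0]
      by (cases "k = 0") (simp_all add: legendre_def jacobi_def jacobi_hom_def zero_power)
  next
    case False
    have "(x + y) * ((1 - (x - y) / (x + y)) / 2) = y" "(x + y) * (((x - y) / (x + y) + 1) / 2) = x"
      using False by (auto simp: field_simps)
    then show ?thesis
      using jacobi_hom_scale[of k 0 "x + y" "(1 - (x - y) / (x + y)) / 2" "((x - y) / (x + y) + 1) / 2"]
        jacobi_eq_jacobi_hom[of k 0] unfolding legendre_def by simp
  qed
  ultimately show ?thesis unfolding bpk_def bhom_def by (simp add: mult_ac)
qed

lemma That_rotate:
  "(x, y) \<in> That \<Longrightarrow> (y, 1 - x - y) \<in> That" "(x, y) \<in> That \<Longrightarrow> (1 - x - y, x) \<in> That"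
  unfolding That_def by auto

text \<open>With \<open>z = 1 - x - y\<close> the operators MR and RM are the rotations to
  \<open>(y, z, x)\<close> and \<open>(z, x, y)\<close>.\<close>

lemma brefl_eq_bhom_refl:
  assumes "(x, y) \<in> That"
  shows "brefl p k (x, y) = bhom_refl p k x y (1 - x - y)"
  using bpk_eq_bhom[OF assms] bpk_eq_bhom[OF That_rotate(1)[OF assms]] bpk_eq_bhom[OF That_rotate(2)[OF assms]]
  unfolding brefl_def Piop_def Mop_def Rop_def bhom_refl_def
  by (simp add: algebra_simps)

text \<open>The projection subtracts the mean over the three rotations.\<close>

lemma bhom_refl_cyclic_sum: "bhom_refl p k x y z + bhom_refl p k y z x + bhom_refl p k z x y = 0"
  unfolding bhom_refl_def by (simp add: field_simps)

text \<open>Parity of the Legendre polynomials: reversing the sum replaces the sign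
  \<open>(- 1) ^ r\<close> by \<open>(- 1) ^ (k - r)\<close>, the same for even
  \<open>k\<close>.\<close>

lemma jacobi_hom_even_commute:
  assumes "even k" shows "jacobi_hom k 0 y x = jacobi_hom k 0 x y"
  unfolding jacobi_hom_def
proof (rule sum.reindex_bij_witness[where i = "\<lambda>r. k - r" and j = "\<lambda>r. k - r"])
  fix r assume r: "r \<in> {..k}"
  have "(- x) ^ (k - r) * y ^ r = x ^ (k - r) * (- y) ^ r"
  proof (cases "even r")
    case True then show ?thesis using assms by simp
  next
    case False then show ?thesis using assms r by simp
  qed
  then show "real (k choose (k - r)) * real (k + 0 choose (k - r)) * (- x) ^ (k - r) * y ^ (k - (k - r))
    = real (k choose r) * real (k + 0 choose r) * (- y) ^ r * x ^ (k - r)"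
    using r by (simp add: binomial_symmetric[symmetric] mult_ac)
qed auto

lemma bhom_even_commute: "bhom p (2 * k) y x z = bhom p (2 * k) x y z"
  unfolding bhom_def by (simp add: jacobi_hom_even_commute[of "2 * k" x y] add.commute)

lemma bhom_refl_commute: "bhom_refl p k y x z = bhom_refl p k x y z"
  unfolding bhom_refl_def
  using bhom_even_commute[of p k x z y] bhom_even_commute[of p k z y x] bhom_even_commute[of p k y x z]
  by simp

section \<open>Harmonicity of the basis\<close>

text \<open>Coefficients of \<open>(x + y) ^ m * jacobi_hom k 0 y x\<close> with respect to
  \<open>x ^ i * y ^ j / (i! j!)\<^sup>2\<close>, where \<open>i + j = m + k\<close>.\<close>
fun scoeff :: "nat \<Rightarrow> nat \<Rightarrow> nat \<Rightarrow> nat \<Rightarrow> real" where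
  "scoeff k 0 i j = (fact k)\<^sup>2 * (- 1) ^ j"
| "scoeff k (Suc m) i j = (real i)\<^sup>2 * scoeff k m (i - 1) j + (real j)\<^sup>2 * scoeff k m i (j - 1)"

text \<open>The lowering half of an \<open>sl\<^sub>2\<close> action whose raising operator is multiplication by \<open>x + y\<close>.\<close>
lemma scoeff_lower:
  assumes "Suc (i + j) = m + k"
  shows "scoeff k m (Suc i) j + scoeff k m i (Suc j)
    = real m * (real m + 2 * real k + 1) * scoeff k (m - 1) i j"
  using assms
proof (induction m arbitrary: i j)
  case 0
  then show ?case by simp
next
  case (Suc m)
  let ?q = "real m * (real m + 2 * real k + 1)"
  let ?G = "scoeff k m i j"
  from Suc.prems have ij: "i + j = m + k" by simp
  \<comment> \<open>For \<open>i = 0\<close> the truncated \<open>i - 1\<close> is hidden by the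
    factor zero; otherwise this is the induction hypothesis solved for its second summand.
    \<open>B\<close> is the mirror image.\<close>
  have A: "(real i)\<^sup>2 * scoeff k m (i - 1) (Suc j) = (real i)\<^sup>2 * (?q * scoeff k (m - 1) (i - 1) j - ?G)"
  proof (cases i)
    case (Suc i')
    then show ?thesis using Suc.IH[of i' j] ij by simp
  qed simp
  have B: "(real j)\<^sup>2 * scoeff k m (Suc i) (j - 1) = (real j)\<^sup>2 * (?q * scoeff k (m - 1) i (j - 1) - ?G)"
  proof (cases j)
    case (Suc j')
    then show ?thesis using Suc.IH[of i j'] ij by simp
  qed simp
  \<comment> \<open>For \<open>m = 0\<close> both sides vanish with \<open>?q\<close>; otherwise
    this is the recursion of \<open>scoeff\<close>.\<close>
  have C: "?q * ((real i)\<^sup>2 * scoeff k (m - 1) (i - 1) j + (real j)\<^sup>2 * scoeff k (m - 1) i (j - 1)) = ?q * ?G"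
    by (cases m) auto
  have "scoeff k (Suc m) (Suc i) j + scoeff k (Suc m) i (Suc j)
     = (real i + 1)\<^sup>2 * ?G + (real j)\<^sup>2 * scoeff k m (Suc i) (j - 1)
       + (real i)\<^sup>2 * scoeff k m (i - 1) (Suc j) + (real j + 1)\<^sup>2 * ?G"
    by (simp add: algebra_simps)
  also have "\<dots> = (2 * (real i + real j) + 2) * ?G
     + ?q * ((real i)\<^sup>2 * scoeff k (m - 1) (i - 1) j + (real j)\<^sup>2 * scoeff k (m - 1) i (j - 1))"
    unfolding A B by (simp add: algebra_simps power2_eq_square)
  also have "\<dots> = (2 * (real m + real k) + 2) * ?G + ?q * ?G"
    unfolding C using ij by (metis of_nat_add)
  finally show ?case by (simp add: algebra_simps)
qed

text \<open>Multiplying \<open>x ^ i / (fact i)\<^sup>2\<close> by \<open>x\<close> yields the next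
  weighted monomial times \<open>(real (Suc i))\<^sup>2\<close>, and likewise for \<open>y\<close>;
  this is the recursion of \<open>scoeff\<close>.\<close>

lemma power_sum_times_legendre_hom:
  "(x + y) ^ m * jacobi_hom k 0 y x = (\<Sum>i\<le>m + k. scoeff k m i (m + k - i)
     * (x ^ i / (fact i)\<^sup>2) * (y ^ (m + k - i) / (fact (m + k - i))\<^sup>2))"
proof (induction m)
  case 0
  have "jacobi_hom k 0 y x = (\<Sum>i\<le>k. (fact k)\<^sup>2 * (- 1) ^ (k - i)
     * (x ^ i / (fact i)\<^sup>2) * (y ^ (k - i) / (fact (k - i))\<^sup>2))"
    unfolding jacobi_hom_def
  proof (rule sum.reindex_bij_witness[where i = "\<lambda>r. k - r" and j = "\<lambda>r. k - r"])
    fix r assume r: "r \<in> {..k}"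
    then have "real (k choose r) = fact k / (fact r * fact (k - r))"
      by (simp add: binomial_fact)
    then show "(fact k)\<^sup>2 * (- 1) ^ (k - (k - r)) * (x ^ (k - r) / (fact (k - r))\<^sup>2)
      * (y ^ (k - (k - r)) / (fact (k - (k - r)))\<^sup>2)
      = real (k choose r) * real (k + 0 choose r) * (- y) ^ r * x ^ (k - r)"
      using r by (simp add: power2_eq_square power_minus[of y] mult_ac)
  qed auto
  then show ?case by simp
next
  case (Suc m)
  define N where "N = m + k"
  let ?t = "\<lambda>i j. (x ^ i / (fact i)\<^sup>2) * (y ^ j / (fact j)\<^sup>2)"
  have X: "x * ?t i j = (real (Suc i))\<^sup>2 * ?t (Suc i) j" for i j
    by (simp add: power_mult_distrib del: of_nat_Suc)
  have Y: "y * ?t i j = (real (Suc j))\<^sup>2 * ?t i (Suc j)" for i j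
    by (simp add: power_mult_distrib del: of_nat_Suc)
  have "(x + y) ^ Suc m * jacobi_hom k 0 y x = (x + y) * (\<Sum>i\<le>N. scoeff k m i (N - i) * ?t i (N - i))"
    using Suc by (simp add: N_def mult.assoc)
  also have "\<dots> = (\<Sum>i\<le>N. scoeff k m i (N - i) * (x * ?t i (N - i)))
      + (\<Sum>i\<le>N. scoeff k m i (N - i) * (y * ?t i (N - i)))"
    by (simp only: distrib_right distrib_left sum_distrib_left sum.distrib mult.left_commute[of _ "scoeff k m _ _"])
  also have "(\<Sum>i\<le>N. scoeff k m i (N - i) * (x * ?t i (N - i)))
      = (\<Sum>i\<le>N. (real (Suc i))\<^sup>2 * scoeff k m (Suc i - 1) (Suc N - Suc i) * ?t (Suc i) (Suc N - Suc i))"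
    unfolding X by (simp add: mult_ac)
  \<comment> \<open>The new term \<open>i = 0\<close> vanishes through its factor
    \<open>(real i)\<^sup>2\<close>; the term \<open>i = Suc N\<close> joins the other sum for the
    same reason.\<close>
  also have "\<dots> = (\<Sum>i\<le>Suc N. (real i)\<^sup>2 * scoeff k m (i - 1) (Suc N - i) * ?t i (Suc N - i))"
    by (subst sum.atMost_Suc_shift) simp
  also have "(\<Sum>i\<le>N. scoeff k m i (N - i) * (y * ?t i (N - i)))
      = (\<Sum>i\<le>N. (real (Suc N - i))\<^sup>2 * scoeff k m i (Suc N - i - 1) * ?t i (Suc N - i))"
    unfolding Y by (rule sum.cong) (auto simp: Suc_diff_le mult_ac)
  also have "\<dots> = (\<Sum>i\<le>Suc N. (real (Suc N - i))\<^sup>2 * scoeff k m i (Suc N - i - 1) * ?t i (Suc N - i))"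
    by simp
  also have "(\<Sum>i\<le>Suc N. (real i)\<^sup>2 * scoeff k m (i - 1) (Suc N - i) * ?t i (Suc N - i))
     + (\<Sum>i\<le>Suc N. (real (Suc N - i))\<^sup>2 * scoeff k m i (Suc N - i - 1) * ?t i (Suc N - i))
     = (\<Sum>i\<le>Suc N. scoeff k (Suc m) i (Suc N - i) * ?t i (Suc N - i))"
    by (simp only: scoeff.simps distrib_right sum.distrib)
  finally show ?case by (simp only: N_def add_Suc mult.assoc)
qed

lemma binomial_Suc_ratio:
  "real (Suc r) * real (n choose Suc r) = (real n - real r) * real (n choose r)"
proof (cases "r \<le> n")
  case True
  have "Suc r * (n choose Suc r) = (n - r) * (n choose r)"
    using binomial_absorb_comp[of n r] binomial_absorption[of r n]
    by (metis Suc_times_binomial_eq binomial_absorption diff_is_0_eq' mult.commute)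
  then have "real (Suc r * (n choose Suc r)) = real ((n - r) * (n choose r))" by simp
  with True show ?thesis by (simp only: of_nat_mult of_nat_diff)
qed (simp add: binomial_eq_0)

text \<open>The coefficient of \<open>z ^ l\<close> is
  \<open>a l * (x + y) ^ m * jacobi_hom k 0 y x\<close> with \<open>m = n - l\<close>. Lowering in
  \<open>x\<close> and \<open>y\<close> produces the factor \<open>m * (m + 2 * k + 1)\<close> by
  \<open>scoeff_lower\<close>, and the ratio of consecutive Jacobi coefficients makes this cancel
  against lowering in \<open>z\<close>.\<close>

lemma bhom_harmonic:
  assumes "k \<le> p"
  shows "bhom p k \<in> harmonic_forms p"
proof -
  define n where "n = p - k"
  define a where "a r = (- 1) ^ r * real (n choose r) * real ((n + (2 * k + 1)) choose r)" for r
  \<comment> \<open>\<open>(fact l)\<^sup>2\<close> undoes the weight of \<open>z ^ l\<close> in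
    \<open>hform\<close>.\<close>
  define c where "c i j l = (if l \<le> n then a l * (fact l)\<^sup>2 * scoeff k (n - l) i j else 0)" for i j l
  have p: "p = n + k" using assms n_def by simp
  have a_Suc: "(real (Suc l))\<^sup>2 * a (Suc l) = - ((real n - real l) * (real n - real l + 2 * real k + 1) * a l)" for l
  proof -
    have "(real (Suc l))\<^sup>2 * a (Suc l) = - ((- 1) ^ l * (real (Suc l) * real (n choose Suc l))
        * (real (Suc l) * real ((n + (2 * k + 1)) choose Suc l)))"
      unfolding a_def power2_eq_square by (simp add: mult_ac del: of_nat_Suc)
    also have "\<dots> = - ((real n - real l) * (real n - real l + 2 * real k + 1) * a l)"
      unfolding binomial_Suc_ratio a_def by (simp add: algebra_simps)
    finally show ?thesis .
  qed
  have "harmonic_coeffs p c"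
    unfolding harmonic_coeffs_def
  proof (intro allI impI)
    fix i j l assume ijl: "Suc (i + j + l) = p"
    consider "l < n" | "l = n" | "l > n" by linarith
    then show "c (Suc i) j l + c i (Suc j) l + c i j (Suc l) = 0"
    proof cases
      case 1
      then have low: "scoeff k (n - l) (Suc i) j + scoeff k (n - l) i (Suc j)
          = (real n - real l) * (real n - real l + 2 * real k + 1) * scoeff k (n - Suc l) i j"
        using scoeff_lower[of i j "n - l" k] ijl p by (simp add: of_nat_diff)
      have "c (Suc i) j l + c i (Suc j) l + c i j (Suc l)
        = (fact l)\<^sup>2 * (a l * (scoeff k (n - l) (Suc i) j + scoeff k (n - l) i (Suc j))
            + ((real (Suc l))\<^sup>2 * a (Suc l)) * scoeff k (n - Suc l) i j)"
        using 1 by (simp add: c_def algebra_simps power2_eq_square)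
      also have "\<dots> = 0" unfolding low a_Suc by (simp add: algebra_simps)
      finally show ?thesis .
    next
      \<comment> \<open>Top degree in \<open>z\<close>: the Legendre form is annihilated on its own,
        by \<open>scoeff_lower\<close> with \<open>m = 0\<close>.\<close>
      case 2
      then show ?thesis
        using scoeff_lower[of i j 0 k] ijl p by (simp add: c_def flip: distrib_left)
    next
      case 3
      then show ?thesis by (simp add: c_def)
    qed
  qed
  moreover have "bhom p k x y z = hform p c x y z" for x y z
  proof -
    have "hform p c x y z = (\<Sum>l\<le>p. if l \<le> n then a l * z ^ l * ((x + y) ^ (n - l) * jacobi_hom k 0 y x) else 0)"
      unfolding hform_nested
    proof (rule sum.cong[OF refl])
      fix l assume "l \<in> {..p}"
      show "(\<Sum>i\<le>p - l. c i (p - l - i) l * (x ^ i / (fact i)\<^sup>2) * (y ^ (p - l - i) / (fact (p - l - i))\<^sup>2))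
          * (z ^ l / (fact l)\<^sup>2)
        = (if l \<le> n then a l * z ^ l * ((x + y) ^ (n - l) * jacobi_hom k 0 y x) else 0)"
      proof (cases "l \<le> n")
        case True
        then have e: "n - l + k = p - l" using p by simp
        have "(\<Sum>i\<le>p - l. c i (p - l - i) l * (x ^ i / (fact i)\<^sup>2) * (y ^ (p - l - i) / (fact (p - l - i))\<^sup>2))
          = a l * (fact l)\<^sup>2 * ((x + y) ^ (n - l) * jacobi_hom k 0 y x)"
          unfolding power_sum_times_legendre_hom e sum_distrib_left using True
          by (simp add: c_def mult_ac)
        with True show ?thesis by simp
      qed (simp add: c_def)
    qed
    also have "\<dots> = (\<Sum>l\<in>{..p} \<inter> {l. l \<le> n}. a l * z ^ l * ((x + y) ^ (n - l) * jacobi_hom k 0 y x))"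
      by (simp add: sum.inter_restrict)
    also have "{..p} \<inter> {l. l \<le> n} = {..n}" using p by auto
    also have "(\<Sum>l\<le>n. a l * z ^ l * ((x + y) ^ (n - l) * jacobi_hom k 0 y x)) = bhom p k x y z"
      unfolding bhom_def n_def[symmetric] jacobi_hom_def[of n] sum_distrib_right
      by (rule sum.cong) (auto simp: a_def power_minus[of z] mult_ac)
    finally show ?thesis by simp
  qed
  ultimately show ?thesis unfolding harmonic_forms_def by blast
qed

lemma bhom_refl_harmonic:
  assumes "2 * k \<le> p"
  shows "bhom_refl p k \<in> harmonic_forms p"
proof -
  note B = bhom_harmonic[OF assms]
  have "(\<lambda>x y z. (1/3) * (2 * bhom p (2 * k) x y z
      + ((- 1) * bhom p (2 * k) y z x + (- 1) * bhom p (2 * k) z x y))) \<in> harmonic_forms p"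
    by (intro harmonic_forms_scale harmonic_forms_add B
        harmonic_forms_rotate[OF B] harmonic_forms_rotate[OF harmonic_forms_rotate[OF B]])
  moreover have "bhom_refl p k = (\<lambda>x y z. (1/3) * (2 * bhom p (2 * k) x y z
      + ((- 1) * bhom p (2 * k) y z x + (- 1) * bhom p (2 * k) z x y)))"
    unfolding bhom_refl_def by (intro ext) (simp add: field_simps)
  ultimately show ?thesis by simp
qed

section \<open>Independence of the projected functions\<close>

text \<open>If the projection of \<open>F = \<Sum> c\<^sub>k b\<^sub>p\<^sub>,\<^sub>2\<^sub>k\<close> vanishes, then \<open>F\<close> is invariant under
  rotations. On the plane \<open>x + y + z = 0\<close> it is divisible by \<open>z\<^sup>e\<close> with \<open>e = p - 2 K\<close>, where \<open>K\<close> is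
  the largest index with \<open>c\<^sub>K \<noteq> 0\<close>, hence also by \<open>x\<^sup>e\<close> and \<open>y\<^sup>e\<close>. Thus \<open>t \<mapsto> F (t, 1 - t, - 1)\<close>
  has degree at least \<open>2 e\<close>, but also at most \<open>2 K < 2 e\<close>.\<close>
lemma bhom_refl_independent:
  fixes c :: "nat \<Rightarrow> real"
  assumes d: "\<And>k. k < d \<Longrightarrow> 3 * k + 1 \<le> p"
    and zero: "\<And>x y z. (\<Sum>k<d. c k * bhom_refl p k x y z) = 0"
    and "k < d"
  shows "c k = 0"
proof (rule ccontr)
  assume "c k \<noteq> 0"
  define K where "K = Max {k. k < d \<and> c k \<noteq> 0}"
  have "K \<in> {k. k < d \<and> c k \<noteq> 0}"
    unfolding K_def using \<open>k < d\<close> \<open>c k \<noteq> 0\<close> by (intro Max_in) auto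
  then have K: "K < d" "c K \<noteq> 0" by auto
  have below: "k \<le> K" if "k < d" "c k \<noteq> 0" for k
    unfolding K_def using that by (intro Max_ge) auto
  define F where "F x y z = (\<Sum>k<d. c k * bhom p (2 * k) x y z)" for x y z
  have "2 * F x y z = F y z x + F z x y" for x y z
  proof -
    have "(\<Sum>k<d. c k * bhom_refl p k x y z) = (2 * F x y z - F y z x - F z x y) / 3"
      unfolding F_def bhom_refl_def
      by (simp add: sum_distrib_left sum_subtractf[symmetric] sum_divide_distrib algebra_simps)
    then show ?thesis using zero by simp
  qed
  \<comment> \<open>Each of the three rotated values is the mean of the other two, so all three
    agree.\<close>
  from this[of x y z for x y z] this[of y z x for x y z]
  have rot: "F x y z = F y z x" "F x y z = F z x y" for x y z
    by (smt (verit))+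
  \<comment> \<open>\<open>J\<close> lifts \<open>jacobi_hom k 0\<close> to polynomial arguments,
    which makes divisibility and degree available.\<close>
  define J where "J k u v = (\<Sum>r\<le>k. smult (real (k choose r) * real (k choose r)) ((- u) ^ r * v ^ (k - r)))"
    for k and u v :: "real poly"
  have poly_J: "poly (J k u v) t = jacobi_hom k 0 (poly u t) (poly v t)" for k u v t
    unfolding J_def jacobi_hom_def by (simp add: poly_sum mult.assoc)
  define \<kappa> where "\<kappa> k = jacobi_hom (p - 2 * k) (2 * (2 * k) + 1) (- 1) 1" for k
  have bhom_inf: "bhom p (2 * k) x y (- (x + y)) = \<kappa> k * (x + y) ^ (p - 2 * k) * jacobi_hom (2 * k) 0 y x" for k x y
    unfolding bhom_def \<kappa>_def by (subst jacobi_hom_at_infinity) simp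
  define e where "e = p - 2 * K"
  \<comment> \<open>\<open>\<eta>\<close> is \<open>F t (1 - t) (- 1)\<close> as a polynomial in
    \<open>t\<close>; since \<open>x + y = 1\<close> there, only the Legendre forms remain.\<close>
  define \<eta> where "\<eta> = (\<Sum>k<d. smult (c k * \<kappa> k) (J (2 * k) [:1, -1:] [:0, 1:]))"
  have \<eta>: "poly \<eta> t = F t (1 - t) (- 1)" for t
    using bhom_inf[of _ t "1 - t"] unfolding \<eta>_def F_def
    by (simp add: poly_sum poly_J mult.assoc)
  have dvdI: "q ^ e dvd (\<Sum>k<d. smult (c k * \<kappa> k) (q ^ (p - 2 * k) * g k))" for q and g :: "nat \<Rightarrow> real poly"
  proof (rule dvd_sum)
    fix k assume "k \<in> {..<d}"
    show "q ^ e dvd smult (c k * \<kappa> k) (q ^ (p - 2 * k) * g k)"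
    proof (cases "c k = 0")
      case False
      with below[of k] \<open>k \<in> {..<d}\<close> have "e \<le> p - 2 * k" unfolding e_def by auto
      then show ?thesis by (intro dvd_smult dvd_mult2 le_imp_power_dvd)
    qed simp
  qed
  \<comment> \<open>The rotated argument has \<open>x + y = - t\<close>, which exposes the factor
    \<open>t ^ e\<close>; the other rotation has \<open>x + y = t - 1\<close> and exposes
    \<open>(t - 1) ^ e\<close>.\<close>
  have "\<eta> = (\<Sum>k<d. smult (c k * \<kappa> k) ((- [:0, 1:]) ^ (p - 2 * k) * J (2 * k) [:-1:] [:1, -1:]))"
  proof (rule poly_eq_poly_eq_iff[THEN iffD1], rule ext)
    fix t
    have "poly \<eta> t = F (1 - t) (- 1) t" unfolding \<eta> rot(1)[of t "1 - t" "- 1"] ..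
    also have "\<dots> = poly (\<Sum>k<d. smult (c k * \<kappa> k) ((- [:0, 1:]) ^ (p - 2 * k) * J (2 * k) [:-1:] [:1, -1:])) t"
      using bhom_inf[of _ "1 - t" "- 1"] unfolding F_def by (simp add: poly_sum poly_J mult.assoc)
    finally show "poly \<eta> t = \<dots>" .
  qed
  then have "(- [:0, 1:]) ^ e dvd \<eta>" using dvdI by simp
  moreover have "[:- 0, 1:] ^ e dvd (- [:0, 1 :: real:]) ^ e"
    by (rule dvd_power_same) (simp only: dvd_minus_iff minus_zero dvd_refl)
  ultimately have dvd0: "[:- 0, 1:] ^ e dvd \<eta>" by (rule dvd_trans[rotated])
  have "\<eta> = (\<Sum>k<d. smult (c k * \<kappa> k) ([:- 1, 1:] ^ (p - 2 * k) * J (2 * k) [:0, 1:] [:-1:]))"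
  proof (rule poly_eq_poly_eq_iff[THEN iffD1], rule ext)
    fix t
    have "poly \<eta> t = F (- 1) t (1 - t)" unfolding \<eta> rot(2)[of t "1 - t" "- 1"] ..
    also have "\<dots> = poly (\<Sum>k<d. smult (c k * \<kappa> k) ([:- 1, 1:] ^ (p - 2 * k) * J (2 * k) [:0, 1:] [:-1:])) t"
      using bhom_inf[of _ "- 1" t] unfolding F_def by (simp add: poly_sum poly_J mult.assoc)
    finally show "poly \<eta> t = \<dots>" .
  qed
  then have dvd1: "[:- 1, 1:] ^ e dvd \<eta>" using dvdI by simp
  \<comment> \<open>Each product is monic of the same degree, so the top coefficient of
    \<open>J\<close> is a sum of squared binomials and cannot cancel.\<close>
  have J_summand: "degree ((- [:1, -1:]) ^ r * [:0, 1 :: real:] ^ (2 * k - r)) = 2 * k"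
      "lead_coeff ((- [:1, -1:]) ^ r * [:0, 1 :: real:] ^ (2 * k - r)) = 1"
    if "r \<le> 2 * k" for r k
  proof -
    show "degree ((- [:1, -1:]) ^ r * [:0, 1 :: real:] ^ (2 * k - r)) = 2 * k"
      using that by (simp add: degree_mult_eq degree_power_eq)
    show "lead_coeff ((- [:1, -1:]) ^ r * [:0, 1 :: real:] ^ (2 * k - r)) = 1"
      by (simp only: lead_coeff_mult lead_coeff_power) simp
  qed
  have deg_J: "degree (J (2 * k) [:1, -1:] [:0, 1:]) \<le> 2 * k" for k
    unfolding J_def
  proof (rule degree_sum_le)
    fix r assume "r \<in> {..2 * k}"
    then show "degree (smult (real (2 * k choose r) * real (2 * k choose r))
        ((- [:1, -1:]) ^ r * [:0, 1:] ^ (2 * k - r))) \<le> 2 * k"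
      using J_summand(1)[of r k] degree_smult_le by (metis atMost_iff)
  qed simp
  have "coeff (J (2 * K) [:1, -1:] [:0, 1:]) (2 * K)
      = (\<Sum>r\<le>2 * K. real (2 * K choose r) * real (2 * K choose r))"
    unfolding J_def coeff_sum coeff_smult
  proof (rule sum.cong[OF refl])
    fix r assume "r \<in> {..2 * K}"
    then have "coeff ((- [:1, -1:]) ^ r * [:0, 1 :: real:] ^ (2 * K - r)) (2 * K) = 1"
      using J_summand[of r K] by simp
    then show "real (2 * K choose r) * real (2 * K choose r)
        * coeff ((- [:1, -1:]) ^ r * [:0, 1 :: real:] ^ (2 * K - r)) (2 * K)
        = real (2 * K choose r) * real (2 * K choose r)" by simp
  qed
  also have "\<dots> > 0" by (rule sum_pos2[of _ 0]) auto
  finally have lead_J: "coeff (J (2 * K) [:1, -1:] [:0, 1:]) (2 * K) > 0" .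
  have "coeff \<eta> (2 * K) = (\<Sum>k<d. if k = K then c K * \<kappa> K * coeff (J (2 * K) [:1, -1:] [:0, 1:]) (2 * K) else 0)"
    unfolding \<eta>_def coeff_sum coeff_smult
  proof (rule sum.cong[OF refl])
    fix k assume "k \<in> {..<d}"
    then have "k \<noteq> K \<Longrightarrow> c k = 0 \<or> coeff (J (2 * k) [:1, -1:] [:0, 1:]) (2 * K) = 0"
      using below[of k] deg_J[of k] by (cases "c k = 0") (auto intro!: coeff_eq_0)
    then show "c k * \<kappa> k * coeff (J (2 * k) [:1, -1:] [:0, 1:]) (2 * K)
       = (if k = K then c K * \<kappa> K * coeff (J (2 * K) [:1, -1:] [:0, 1:]) (2 * K) else 0)"
      by auto
  qed
  also have "\<dots> = c K * \<kappa> K * coeff (J (2 * K) [:1, -1:] [:0, 1:]) (2 * K)"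
    using K by simp
  also have "\<dots> \<noteq> 0"
    using K lead_J jacobi_hom_minus_one_pos[of "p - 2 * K" "2 * (2 * K) + 1"] unfolding \<kappa>_def by simp
  finally have "\<eta> \<noteq> 0" by auto
  have deg_\<eta>: "degree \<eta> \<le> 2 * K"
    unfolding \<eta>_def
  proof (rule degree_sum_le)
    fix k assume "k \<in> {..<d}"
    then show "degree (smult (c k * \<kappa> k) (J (2 * k) [:1, -1:] [:0, 1:])) \<le> 2 * K"
      using below[of k] deg_J[of k] by (cases "c k = 0") (auto intro!: order.trans[OF degree_smult_le])
  qed simp
  from dvd0 obtain q where q: "\<eta> = [:0, 1:] ^ e * q" by (auto elim: dvdE)
  with \<open>\<eta> \<noteq> 0\<close> have "q \<noteq> 0" by auto
  have "e \<le> order 1 \<eta>" using dvd1 \<open>\<eta> \<noteq> 0\<close> order_divides by blast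
  also have "order 1 \<eta> = order 1 ([:0, 1 :: real:] ^ e) + order 1 q"
    using \<open>\<eta> \<noteq> 0\<close> unfolding q by (rule order_mult)
  also have "order 1 ([:0, 1 :: real:] ^ e) = 0" by (rule order_0I) simp
  finally have "e \<le> degree q" using order_degree[OF \<open>q \<noteq> 0\<close>, of 1] by simp
  moreover have "degree \<eta> = e + degree q"
    unfolding q using \<open>q \<noteq> 0\<close> by (simp add: degree_mult_eq degree_power_eq)
  ultimately have "2 * e \<le> 2 * K" using deg_\<eta> by simp
  \<comment> \<open>\<open>3 * K + 1 \<le> p\<close> means \<open>K < e\<close>.\<close>
  with d[OF K(1)] show False unfolding e_def by simp
qed

section \<open>Functions on the boundary of the tetrahedron\<close>

lemma chi_rotate: "chi V W U (x, y) = chi W U V (y, 1 - x - y)"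
  unfolding chi_def by (simp add: algebra_simps)

lemma chi_swap: "chi V W U (x, y) = chi V U W (y, x)"
  unfolding chi_def by (simp add: algebra_simps)

lemma chi_image_That: "chi V W U ` That = convex hull {V, W, U}"
proof -
  have "chi V W U (x, y) \<in> convex hull {V, W, U}" if "(x, y) \<in> That" for x y
  proof -
    have "chi V W U (x, y) = (1 - x - y) *\<^sub>R V + x *\<^sub>R W + y *\<^sub>R U"
      unfolding chi_def by (simp add: algebra_simps)
    moreover have "0 \<le> 1 - x - y" "0 \<le> x" "0 \<le> y" "(1 - x - y) + x + y = 1"
      using that by (auto simp: That_def)
    ultimately show ?thesis unfolding convex_hull_3 by blast
  qed
  moreover have "p \<in> chi V W U ` That" if "p \<in> convex hull {V, W, U}" for p
  proof -
    from that obtain u v w where "0 \<le> u" "0 \<le> v" "0 \<le> w" "u + v + w = 1"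
      and p: "p = u *\<^sub>R V + v *\<^sub>R W + w *\<^sub>R U"
      unfolding convex_hull_3 by auto
    then have u: "u = 1 - v - w" and "(v, w) \<in> That" by (auto simp: That_def)
    moreover have "p = chi V W U (v, w)" unfolding p u chi_def by (simp add: algebra_simps)
    ultimately show ?thesis by blast
  qed
  ultimately show ?thesis by auto
qed

lemma inj_chi:
  assumes "\<not> affine_dependent {V, W, U}" and "distinct [V, W, U]"
  shows "inj (chi V W U)"
proof (rule injI)
  fix x y assume eq: "chi V W U x = chi V W U y"
  define a where "a = fst x - fst y"
  define b where "b = snd x - snd y"
  have ab: "a *\<^sub>R (W - V) + b *\<^sub>R (U - V) = 0"
    using eq unfolding chi_def a_def b_def by (simp add: algebra_simps)
  define u where "u v = (if v = V then - a - b else if v = W then a else b)" for v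
  have "sum u {V, W, U} = 0" "(\<Sum>v\<in>{V, W, U}. u v *\<^sub>R v) = 0"
    using assms(2) ab by (auto simp: u_def algebra_simps)
  with assms(1) have "\<forall>v\<in>{V, W, U}. u v = 0"
    unfolding affine_dependent_explicit_finite[OF finite.insertI[OF finite.insertI[OF finite.insertI[OF finite.emptyI]]]]
    by blast
  then have "a = 0" "b = 0" using assms(2) by (auto simp: u_def split: if_splits)
  then show "x = y" unfolding a_def b_def by (simp add: prod_eq_iff)
qed

text \<open>Reconciles the range of the functions with the range in \<open>Pperp_hat\<close>; both
  are empty for \<open>p = 0\<close>.\<close>

lemma less_drefl_iff: "k < drefl p \<longleftrightarrow> 3 * k + 1 \<le> p"
  unfolding drefl_def by linarith

section \<open>Independence on the boundary\<close>

text \<open>On the facet opposite to \<open>A m\<close>, summing the relation over the three rotations of the facet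
  annihilates the contributions of the vertices of the facet, while the totally symmetric
  contribution of \<open>A m\<close> survives.\<close>
lemma Q_coeffs_zero:
  fixes c :: "nat \<Rightarrow> nat \<Rightarrow> real"
  assumes Q: "\<forall>i\<in>{0..3}. \<forall>k<drefl p. Qprop p A i k (Q i k)"
    and rel: "\<forall>y\<in>bdry A. (\<Sum>i\<in>{0..3}. \<Sum>k<drefl p. c i k * Q i k y) = 0"
    and m: "m \<in> {0..3}" and "k < drefl p"
  shows "c m k = 0"
proof -
  have "\<exists>i j l. {0..3} = {i, j, l, m} \<and> distinct [i, j, l, m]"
  proof -
    have s: "{0..3::nat} = {0, 1, 2, 3}" by auto
    with m consider "m = 0" | "m = 1" | "m = 2" | "m = 3" by auto
    then show ?thesis
    proof cases
      case 1 then show ?thesis unfolding s by (intro exI[of _ 1] exI[of _ 2] exI[of _ 3]) auto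
    next
      case 2 then show ?thesis unfolding s by (intro exI[of _ 0] exI[of _ 2] exI[of _ 3]) auto
    next
      case 3 then show ?thesis unfolding s by (intro exI[of _ 0] exI[of _ 1] exI[of _ 3]) auto
    next
      case 4 then show ?thesis unfolding s by (intro exI[of _ 0] exI[of _ 1] exI[of _ 2]) auto
    qed
  qed
  then obtain i j l where ijl: "{0..3} = {i, j, l, m}" and dist: "distinct [i, j, l, m]" by blast
  have "\<forall>k. \<exists>S. k < drefl p \<longrightarrow> (tot_sym S \<and> (\<forall>t\<in>{0..1}. S (t, 1 - t) = brefl p k (t, 1 - t))
      \<and> (\<forall>x\<in>That. Q m k (chi (A i) (A j) (A l) x) = S x))"
  proof
    fix k
    show "\<exists>S. k < drefl p \<longrightarrow> (tot_sym S \<and> (\<forall>t\<in>{0..1}. S (t, 1 - t) = brefl p k (t, 1 - t))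
      \<and> (\<forall>x\<in>That. Q m k (chi (A i) (A j) (A l) x) = S x))"
    proof (cases "k < drefl p")
      case True
      with Q m have "Qprop p A m k (Q m k)" by blast
      then obtain S where S: "tot_sym S" "\<forall>t\<in>{0..1}. S (t, 1 - t) = brefl p k (t, 1 - t)"
        and *: "\<And>j l n x. {j, l, n} \<subseteq> {0..3} \<Longrightarrow> distinct [m, j, l, n] \<Longrightarrow> x \<in> That \<Longrightarrow>
             Q m k (chi (A j) (A l) (A n) x) = S x"
        unfolding Qprop_def by metis
      have "\<forall>x\<in>That. Q m k (chi (A i) (A j) (A l) x) = S x"
        using *[of i j l] dist ijl by auto
      with S show ?thesis by blast
    qed simp
  qed
  then obtain S where S: "\<And>k. k < drefl p \<Longrightarrow> tot_sym (S k)"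
      "\<And>k t. k < drefl p \<Longrightarrow> t \<in> {0..1} \<Longrightarrow> S k (t, 1 - t) = brefl p k (t, 1 - t)"
      "\<And>k x. k < drefl p \<Longrightarrow> x \<in> That \<Longrightarrow> Q m k (chi (A i) (A j) (A l) x) = S k x"
    by metis
  have Qv: "Q v k (chi (A v) (A w) (A u) (x, y)) = bhom_refl p k x y (1 - x - y)"
    if "k < drefl p" "{v, w, u} \<subseteq> {0..3}" "distinct [v, w, u]" "(x, y) \<in> That" for k v w u x y
  proof -
    have "Qprop p A v k (Q v k)" using Q that(1,2) by auto
    then have "Q v k (chi (A v) (A w) (A u) (x, y)) = brefl p k (x, y)"
      unfolding Qprop_def using that(2-4) by blast
    then show ?thesis using brefl_eq_bhom_refl[OF that(4)] by simp
  qed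
  \<comment> \<open>\<open>U v\<close> is the part of the relation coming from a vertex
    \<open>v\<close>, in coordinates based at \<open>v\<close>; \<open>W\<close> is the part of
    \<open>m\<close> on the opposite facet.\<close>
  define U where "U v x y z = (\<Sum>k<drefl p. c v k * bhom_refl p k x y z)" for v x y z
  define W where "W x = (\<Sum>k<drefl p. c m k * S k x)" for x
  have U_cyclic: "U v x y z + U v y z x + U v z x y = 0" for v x y z
    unfolding U_def sum.distrib[symmetric] distrib_left[symmetric] bhom_refl_cyclic_sum by simp
  \<comment> \<open>The point is given in the chart based at \<open>A i\<close>. The functions of
    \<open>j\<close> and \<open>l\<close> are read in charts based at their own vertices, hence the
    rotated arguments.\<close>
  have eq: "U i x y (1 - x - y) + U j y (1 - x - y) x + U l (1 - x - y) x y + W (x, y) = 0"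
    if xy: "(x, y) \<in> That" for x y
  proof -
    let ?Y = "chi (A i) (A j) (A l) (x, y)"
    have Y1: "?Y = chi (A j) (A l) (A i) (y, 1 - x - y)" by (rule chi_rotate)
    have Y2: "?Y = chi (A l) (A i) (A j) (1 - x - y, x)"
      unfolding Y1 chi_rotate[of "A j" "A l" "A i"] by (simp add: algebra_simps)
    have sub: "{i, j, l} \<subseteq> {0..3}" "{j, l, i} \<subseteq> {0..3}" "{l, i, j} \<subseteq> {0..3}" using ijl by auto
    have "?Y \<in> convex hull {A i, A j, A l}" using chi_image_That xy by blast
    also have "{A i, A j, A l} = A ` ({0..3} - {m})" unfolding ijl using dist by auto
    finally have "?Y \<in> bdry A" unfolding bdry_def using m by blast
    with rel have "(\<Sum>v\<in>{0..3}. \<Sum>k<drefl p. c v k * Q v k ?Y) = 0" by blast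
    then have "(\<Sum>k<drefl p. c i k * Q i k ?Y) + (\<Sum>k<drefl p. c j k * Q j k ?Y)
      + (\<Sum>k<drefl p. c l k * Q l k ?Y) + (\<Sum>k<drefl p. c m k * Q m k ?Y) = 0"
      unfolding ijl using dist by (simp add: add.assoc)
    moreover have "(\<Sum>k<drefl p. c i k * Q i k ?Y) = U i x y (1 - x - y)"
      unfolding U_def using Qv[OF _ sub(1) _ xy] dist by (intro sum.cong) auto
    moreover have "(\<Sum>k<drefl p. c j k * Q j k ?Y) = U j y (1 - x - y) x"
      unfolding U_def Y1 using Qv[OF _ sub(2) _ That_rotate(1)[OF xy]] dist by (intro sum.cong) auto
    moreover have "(\<Sum>k<drefl p. c l k * Q l k ?Y) = U l (1 - x - y) x y"
      unfolding U_def Y2 using Qv[OF _ sub(3) _ That_rotate(2)[OF xy]] dist by (intro sum.cong) auto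
    moreover have "(\<Sum>k<drefl p. c m k * Q m k ?Y) = W (x, y)"
      unfolding W_def using S(3) xy by (intro sum.cong) auto
    ultimately show ?thesis by simp
  qed
  have W_sym: "W (y, 1 - x - y) = W (x, y)" "W (1 - x - y, x) = W (x, y)" if "(x, y) \<in> That" for x y
  proof -
    have "S k (y, 1 - x - y) = S k (x, y)" "S k (1 - x - y, x) = S k (x, y)" if "k < drefl p" for k
      using S(1)[OF that] \<open>(x, y) \<in> That\<close> unfolding tot_sym_def That_maps_def by fastforce+
    then show "W (y, 1 - x - y) = W (x, y)" "W (1 - x - y, x) = W (x, y)"
      unfolding W_def by simp_all
  qed
  have W_zero: "W (x, y) = 0" if xy: "(x, y) \<in> That" for x y
  proof -
    define z where "z = 1 - x - y"
    have z: "1 - y - z = x" "1 - z - x = y" unfolding z_def by auto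
    have "U i x y z + U j y z x + U l z x y + W (x, y) = 0"
      using eq[OF xy] unfolding z_def by simp
    moreover have "U i y z x + U j z x y + U l x y z + W (x, y) = 0"
      using eq[OF That_rotate(1)[OF xy]] W_sym(1)[OF xy] unfolding z_def[symmetric] z by simp
    moreover have "U i z x y + U j x y z + U l y z x + W (x, y) = 0"
      using eq[OF That_rotate(2)[OF xy]] W_sym(2)[OF xy] unfolding z_def[symmetric] z by simp
    ultimately show ?thesis
      using U_cyclic[of i x y z] U_cyclic[of j x y z] U_cyclic[of l x y z] by linarith
  qed
  have "U m t (1 - t) 0 = 0" if "0 < t" "t < 1" for t
  proof -
    have T: "(t, 1 - t) \<in> That" using that unfolding That_def by auto
    have "U m t (1 - t) 0 = W (t, 1 - t)"
      unfolding U_def W_def using S(2)[of _ t] that brefl_eq_bhom_refl[OF T] by (intro sum.cong) auto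
    then show ?thesis using W_zero[OF T] by simp
  qed
  moreover have "U m \<in> harmonic_forms p"
  proof -
    have "(\<lambda>x y z. \<Sum>k<drefl p. c m k * bhom_refl p k x y z) \<in> harmonic_forms p"
      by (intro harmonic_forms_sum harmonic_forms_scale bhom_refl_harmonic) (auto simp: less_drefl_iff)
    then show ?thesis unfolding U_def[abs_def] .
  qed
  ultimately have "U m x y z = 0" for x y z by (rule harmonic_form_zero_if_zero_on_edge[rotated])
  then show ?thesis
    using bhom_refl_independent[of "drefl p" p "c m" k] \<open>k < drefl p\<close> less_drefl_iff
    unfolding U_def by blast
qed

section \<open>The span on a single facet\<close>

lemma brefl_commute:
  assumes "(x, y) \<in> That"
  shows "brefl p k (y, x) = brefl p k (x, y)"
proof -
  have "(y, x) \<in> That" using assms unfolding That_def by auto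
  then show ?thesis
    using brefl_eq_bhom_refl[OF assms] brefl_eq_bhom_refl[of y x p k]
      bhom_refl_commute[of p k y x "1 - x - y"] by (simp add: algebra_simps)
qed

lemma brefl_cyclic_sum:
  assumes "(x, y) \<in> That"
  shows "brefl p k (x, y) + brefl p k (y, 1 - x - y) + brefl p k (1 - x - y, x) = 0"
  using brefl_eq_bhom_refl[OF assms] brefl_eq_bhom_refl[OF That_rotate(1)[OF assms]]
    brefl_eq_bhom_refl[OF That_rotate(2)[OF assms]] bhom_refl_cyclic_sum[of p k x y "1 - x - y"]
  by (simp add: algebra_simps)

text \<open>By the symmetry of \<open>brefl\<close>, the order of the two vertices other than
  \<open>V\<close> in the chart does not affect the transported function.\<close>

lemma brefl_inv_chi:
  assumes "inj (chi V W U)" "(x, y) \<in> That" "z = chi V W U (x, y) \<or> z = chi V W U (y, x)"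
  shows "brefl p k (inv_into That (chi V W U) z) = brefl p k (x, y)"
proof -
  have "(y, x) \<in> That" using assms(2) unfolding That_def by auto
  moreover have "inj_on (chi V W U) That" using assms(1) inj_on_subset by blast
  ultimately show ?thesis using assms(2,3) brefl_commute[OF assms(2)] inv_into_f_f by metis
qed

text \<open>Seen in the chart at \<open>P\<close>, the functions based at the other two vertices are
  the MR and RM images of \<open>brefl\<close>, and those based at \<open>P\<close> are minus the
  sum of these. The generators at \<open>P\<close> thus add nothing to the span.\<close>

lemma facet_span_eq:
  fixes ch :: "nat \<Rightarrow> nat \<times> nat" and A :: "nat \<Rightarrow> real^3"
  assumes inj: "inj_on A {0..3}" and indep: "\<not> affine_dependent (A ` {0..3})"
    and sub: "I \<subseteq> {0..3}" and P: "P \<in> I"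
    and ch: "\<And>v. v \<in> I \<Longrightarrow> {v, fst (ch v), snd (ch v)} = I \<and> distinct [v, fst (ch v), snd (ch v)]"
    and chV: "chV = (\<lambda>v. chi (A v) (A (fst (ch v))) (A (snd (ch v))))"
    and T: "T = convex hull (A ` I)"
  shows "{g. \<exists>c :: nat \<Rightarrow> nat \<Rightarrow> real. \<forall>y\<in>T.
            g y = (\<Sum>v\<in>I. \<Sum>m<drefl p. c v m * brefl p m (inv_into That (chV v) y))}
       = {g. \<exists>u\<in>Pperp_hat p. \<forall>y\<in>T. g y = u (inv_into That (chV P) y)}" (is "?L = ?R")
proof -
  define v where "v = fst (ch P)"
  define w where "w = snd (ch P)"
  have I: "I = {P, v, w}" and dist: "distinct [P, v, w]"
    using ch[OF P] unfolding v_def w_def by auto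
  have injchi: "inj (chV a)" if "a \<in> I" for a
  proof -
    let ?b = "fst (ch a)" and ?d = "snd (ch a)"
    have "{A a, A ?b, A ?d} \<subseteq> A ` {0..3}" using ch[OF that] sub by blast
    then have "\<not> affine_dependent {A a, A ?b, A ?d}" using indep affine_dependent_subset by blast
    moreover have "distinct [A a, A ?b, A ?d]"
    proof -
      have "a \<in> {0..3}" "?b \<in> {0..3}" "?d \<in> {0..3}" using ch[OF that] sub by blast+
      then show ?thesis using ch[OF that] inj by (auto simp: inj_on_eq_iff)
    qed
    ultimately show ?thesis unfolding chV by (rule inj_chi)
  qed
  \<comment> \<open>The choice \<open>ch\<close> is determined only up to a swap of the two
    remaining vertices.\<close>
  have ch_cases: "ch a = (b, d) \<or> ch a = (d, b)" if "I = {a, b, d}" for a b d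
  proof -
    have a: "a \<in> I" using that by blast
    have "fst (ch a) \<in> {a, b, d}" "snd (ch a) \<in> {a, b, d}"
      unfolding that[symmetric] using ch[OF a] by blast+
    moreover have "distinct [a, fst (ch a), snd (ch a)]" using ch[OF a] by blast
    ultimately show ?thesis by (auto simp: prod_eq_iff)
  qed
  have TP: "T = chV P ` That" unfolding T I chV chi_image_That v_def w_def by simp
  define X where "X = inv_into That (chV P)"
  have X: "X y \<in> That" "chV P (X y) = y" if "y \<in> T" for y
    using that unfolding TP X_def by (auto intro: inv_into_into f_inv_into_f)
  have vals: "brefl p m (inv_into That (chV v) y) = Mop (Rop (brefl p m)) (X y)" (is ?v)
      "brefl p m (inv_into That (chV w) y) = Rop (Mop (brefl p m)) (X y)" (is ?w)
      "brefl p m (inv_into That (chV P) y) = - Mop (Rop (brefl p m)) (X y) - Rop (Mop (brefl p m)) (X y)" (is ?P)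
    if "y \<in> T" for m y
  proof -
    obtain a b where ab: "X y = (a, b)" by (cases "X y")
    have T: "(a, b) \<in> That" using X(1)[OF that] ab by simp
    have y: "y = chi (A P) (A v) (A w) (a, b)"
      using X(2)[OF that] ab unfolding chV v_def w_def by simp
    have y1: "y = chi (A v) (A w) (A P) (b, 1 - a - b)" unfolding y by (rule chi_rotate)
    have y2: "y = chi (A w) (A P) (A v) (1 - a - b, a)"
      unfolding y1 chi_rotate[of "A v" "A w" "A P"] by (simp add: algebra_simps)
    have MR: "Mop (Rop (brefl p m)) (X y) = brefl p m (b, 1 - a - b)"
      and RM: "Rop (Mop (brefl p m)) (X y) = brefl p m (1 - a - b, a)"
      unfolding ab Mop_def Rop_def by (simp_all add: algebra_simps)
    have "ch v = (w, P) \<or> ch v = (P, w)" using ch_cases[of v w P] I dist by auto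
    then have "y = chV v (b, 1 - a - b) \<or> y = chV v (1 - a - b, b)"
      using y1 chi_swap[of "A v" "A w" "A P" b "1 - a - b"] unfolding chV by auto
    then show ?v
      using brefl_inv_chi[OF _ That_rotate(1)[OF T]] injchi[of v] unfolding MR chV I by simp
    have "ch w = (P, v) \<or> ch w = (v, P)" using ch_cases[of w P v] I dist by auto
    then have "y = chV w (1 - a - b, a) \<or> y = chV w (a, 1 - a - b)"
      using y2 chi_swap[of "A w" "A P" "A v" "1 - a - b" a] unfolding chV by auto
    then show ?w
      using brefl_inv_chi[OF _ That_rotate(2)[OF T]] injchi[of w] unfolding RM chV I by simp
    show ?P
      unfolding MR RM unfolding X_def[symmetric] ab using brefl_cyclic_sum[OF T, of p m] by simp
  qed
  have expand: "(\<Sum>v\<in>I. \<Sum>m<drefl p. c v m * brefl p m (inv_into That (chV v) y))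
      = (\<Sum>k<drefl p. (c w k - c P k) * Rop (Mop (brefl p k)) (X y)
           + (c v k - c P k) * Mop (Rop (brefl p k)) (X y))"
    if "y \<in> T" for c y
  proof -
    have "(\<Sum>v\<in>I. \<Sum>m<drefl p. c v m * brefl p m (inv_into That (chV v) y))
      = (\<Sum>m<drefl p. c P m * brefl p m (inv_into That (chV P) y)
          + (c v m * brefl p m (inv_into That (chV v) y) + c w m * brefl p m (inv_into That (chV w) y)))"
      unfolding I using dist by (simp add: sum.distrib)
    also have "\<dots> = (\<Sum>k<drefl p. (c w k - c P k) * Rop (Mop (brefl p k)) (X y)
           + (c v k - c P k) * Mop (Rop (brefl p k)) (X y))"
      unfolding vals[OF that] by (intro sum.cong) (auto simp: algebra_simps)
    finally show ?thesis .
  qed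
  have index: "{k. 3 * k + 1 \<le> p} = {..<drefl p}" by (auto simp: less_drefl_iff)
  show ?thesis
  proof (intro set_eqI iffI)
    fix g assume "g \<in> ?L"
    then obtain c where c: "\<And>y. y \<in> T \<Longrightarrow>
        g y = (\<Sum>v\<in>I. \<Sum>m<drefl p. c v m * brefl p m (inv_into That (chV v) y))" by auto
    define u where "u x = (\<Sum>k<drefl p. (c w k - c P k) * Rop (Mop (brefl p k)) x
           + (c v k - c P k) * Mop (Rop (brefl p k)) x)" for x
    have "u \<in> Pperp_hat p"
      unfolding Pperp_hat_def index u_def
      by (intro CollectI exI[of _ "\<lambda>k. c w k - c P k"] exI[of _ "\<lambda>k. c v k - c P k"]) simp
    moreover have "g y = u (inv_into That (chV P) y)" if "y \<in> T" for y
      unfolding c[OF that] expand[OF that] u_def X_def ..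
    ultimately show "g \<in> ?R" by blast
  next
    fix g assume "g \<in> ?R"
    then obtain u a b where u: "\<And>x. x \<in> That \<Longrightarrow> u x = (\<Sum>k<drefl p.
               a k * Rop (Mop (brefl p k)) x + b k * Mop (Rop (brefl p k)) x)"
      and g: "\<And>y. y \<in> T \<Longrightarrow> g y = u (X y)"
      unfolding Pperp_hat_def index X_def by blast
    \<comment> \<open>With coefficient 0 at \<open>P\<close>, the differences in
      \<open>expand\<close> are just \<open>a\<close> and \<open>b\<close>.\<close>
    define c where "c r k = (if r = w then a k else if r = v then b k else 0)" for r k
    have "g y = (\<Sum>v\<in>I. \<Sum>m<drefl p. c v m * brefl p m (inv_into That (chV v) y))" if "y \<in> T" for y
      unfolding expand[OF that] g[OF that] u[OF X(1)[OF that]] using dist by (auto simp: c_def)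
    then show "g \<in> ?L" by blast
  qed
qed

theorem theorem31:
  fixes p :: nat and A :: "nat \<Rightarrow> real^3"
  assumes "inj_on A {0..3}" and "\<not> affine_dependent (A ` {0..3})"
  shows "(\<forall>Q :: nat \<Rightarrow> nat \<Rightarrow> real^3 \<Rightarrow> real.
            (\<forall>i\<in>{0..3}. \<forall>k<drefl p. Qprop p A i k (Q i k)) \<longrightarrow>
            (\<forall>c :: nat \<Rightarrow> nat \<Rightarrow> real.
               (\<forall>y\<in>bdry A. (\<Sum>i\<in>{0..3}. \<Sum>k<drefl p. c i k * Q i k y) = 0) \<longrightarrow>
               (\<forall>i\<in>{0..3}. \<forall>k<drefl p. c i k = 0)))
       \<and> (\<forall>i j l (ch :: nat \<Rightarrow> nat \<times> nat) P.
            {i, j, l} \<subseteq> {0..3} \<and> distinct [i, j, l] \<and> P \<in> {i, j, l} \<and>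
            (\<forall>v\<in>{i, j, l}. {v, fst (ch v), snd (ch v)} = {i, j, l}
                             \<and> distinct [v, fst (ch v), snd (ch v)]) \<longrightarrow>
            (let T = convex hull {A i, A j, A l};
                 chV = (\<lambda>v. chi (A v) (A (fst (ch v))) (A (snd (ch v))))
             in {g. \<exists>c :: nat \<Rightarrow> nat \<Rightarrow> real. \<forall>y\<in>T.
                      g y = (\<Sum>v\<in>{i, j, l}. \<Sum>m<drefl p.
                               c v m * brefl p m (inv_into That (chV v) y))}
              = {g. \<exists>u\<in>Pperp_hat p. \<forall>y\<in>T. g y = u (inv_into That (chV P) y)}))"
proof (intro conjI allI impI)
  fix Q :: "nat \<Rightarrow> nat \<Rightarrow> real^3 \<Rightarrow> real" and c :: "nat \<Rightarrow> nat \<Rightarrow> real"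
  assume "\<forall>i\<in>{0..3}. \<forall>k<drefl p. Qprop p A i k (Q i k)"
    and "\<forall>y\<in>bdry A. (\<Sum>i\<in>{0..3}. \<Sum>k<drefl p. c i k * Q i k y) = 0"
  then show "\<forall>i\<in>{0..3}. \<forall>k<drefl p. c i k = 0" using Q_coeffs_zero by blast
next
  fix i j l P :: nat and ch :: "nat \<Rightarrow> nat \<times> nat"
  assume H: "{i, j, l} \<subseteq> {0..3} \<and> distinct [i, j, l] \<and> P \<in> {i, j, l} \<and>
            (\<forall>v\<in>{i, j, l}. {v, fst (ch v), snd (ch v)} = {i, j, l}
                             \<and> distinct [v, fst (ch v), snd (ch v)])"
  show "let T = convex hull {A i, A j, A l};
            chV = (\<lambda>v. chi (A v) (A (fst (ch v))) (A (snd (ch v))))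
        in {g. \<exists>c :: nat \<Rightarrow> nat \<Rightarrow> real. \<forall>y\<in>T.
                 g y = (\<Sum>v\<in>{i, j, l}. \<Sum>m<drefl p.
                          c v m * brefl p m (inv_into That (chV v) y))}
         = {g. \<exists>u\<in>Pperp_hat p. \<forall>y\<in>T. g y = u (inv_into That (chV P) y)}"
    unfolding Let_def
    by (rule facet_span_eq[OF assms, of "{i, j, l}" P ch]) (use H in auto)
qed

end
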